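(* Let $(\hat{\mathfrak{g}},[\,,\,]_{\wedge_1},\hat N_1)$ and $(\hat{\mathfrak{g}},[\,,\,]_{\wedge_2},\hat N_2)$ be two isomorphic abelian extensions of a Nijenhuis Leibniz algebra $(\mathfrak{g},[\,,\,],N)$ by $(V,\mu,N_V)$. Then they give rise to the same element in $H^2_{NLA}(\mathfrak{g},V)$; i.e. the two extensions induce the same representation on $V$, and the classes of the pairs $(\psi_1,\chi_1)$ and $(\psi_2,\chi_2)$ associated with them (through arbitrary sections) coincide.
   Context: All vector spaces are over a field $\mathbb{K}$ of characteristic $0$. A (left) Leibniz algebra is a vector space with a bilinear bracket satisfying $[x,[y,z]]=[[x,y],z]+[y,[x,z]]$. A Nijenhuis operator is a linear map $N$ with $[Nx,Ny]=N([Nx,y]+[x,Ny]-N[x,y])$; a Nijenhuis Leibniz algebra is a Leibniz algebra with a Nijenhuis operator; morphisms are Leibniz algebra morphisms commuting with the Nijenhuis operators. Let $V$ be a vector space with a linear operator $N_V$ and trivial bracket $\mu=0$; then $(V,\mu,N_V)$ is a Nijenhuis Leibniz algebra. An abelian extension of $(\mathfrak{g},[\,,\,],N)$ by $(V,\mu,N_V)$ is a Nijenhuis Leibniz algebra $(\hat{\mathfrak{g}},[\,,\,]_\wedge,\hat N)$ with a short exact sequence of morphisms of Nijenhuis Leibniz algebras $0\to V\xrightarrow{i}\hat{\mathfrak{g}}\xrightarrow{p}\mathfrak{g}\to0$. One identifies $V$ with $i(V)$. Two abelian extensions, with maps $(i_1,p_1)$ and $(i_2,p_2)$, are isomorphic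 if there is an isomorphism of Nijenhuis Leibniz algebras $\xi$ from the first to the second with $\xi\circ i_1=i_2$ and $p_2\circ\xi=p_1$. A section is a linear map $s:\mathfrak{g}\to\hat{\mathfrak{g}}$ with $p\circ s=\mathrm{Id}_{\mathfrak{g}}$. It induces on $V$ the representation $\bar l_V(x,u)=[s(x),u]_\wedge$, $\bar r_V(u,x)=[u,s(x)]_\wedge$, with operator $N_V$ (independent of $s$), and the pair $(\psi,\chi)$, $\psi(x\otimes y)=[s(x),s(y)]_\wedge-s([x,y])$, $\chi(x)=\hat N(s(x))-s(N(x))$, in $C^2_{NLA}(\mathfrak{g},V)$. Cochains: $C^1_{NLA}(\mathfrak{g},V)=\mathrm{Hom}(\mathfrak{g},V)\oplus V$, $C^2_{NLA}(\mathfrak{g},V)=\mathrm{Hom}(\mathfrak{g}^{\otimes2},V)\oplus\mathrm{Hom}(\mathfrak{g},V)$, and $d^1(f,g)=(\delta^1f,-\partial^0g-\phi^1f)$, where $(\delta^1f)(x,y)=\bar l_V(x,f(y))+\bar r_V(f(x),y)-f([x,y])$, $(\partial^0g)(x)=-\big(\bar r_V(g,Nx)-N_V\bar r_V(g,x)+\bar r_V(N_Vg,x)\big)$, $\phi^1(f)=f\circ N-N_V\circ f$. $H^2_{NLA}(\mathfrak{g},V)$ is the space of $2$-cocycles modulo $B^2_{NLA}=\mathrm{im}\,d^1$; two elements are in the same class when they differ by an element of $B^2_{NLA}$. The element of $H^2_{NLA}(\mathfrak{g},V)$ to which an extension gives rise is the class of $(\psi,\chi)$ for any section. *)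

theory Defs
  imports Complex_Main "HOL-Library.Function_Algebras" "HOL-Library.Product_Plus"
    "HOL-Library.Set_Algebras"
begin

definition bilinear_map ::
  "('k::field \<Rightarrow> 'a::ab_group_add \<Rightarrow> 'a) \<Rightarrow> ('k \<Rightarrow> 'b::ab_group_add \<Rightarrow> 'b) \<Rightarrow>
   ('k \<Rightarrow> 'c::ab_group_add \<Rightarrow> 'c) \<Rightarrow> ('a \<Rightarrow> 'b \<Rightarrow> 'c) \<Rightarrow> bool" where
  "bilinear_map sa sb sc h \<longleftrightarrow>
     (\<forall>x. Vector_Spaces.linear sb sc (h x)) \<and> (\<forall>y. Vector_Spaces.linear sa sc (\<lambda>x. h x y))"

locale leibniz_algebra = vector_space scale
  for scale :: "'k::field_char_0 \<Rightarrow> 'a::ab_group_add \<Rightarrow> 'a" +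
  fixes br :: "'a \<Rightarrow> 'a \<Rightarrow> 'a"
  assumes br_bilinear: "bilinear_map scale scale scale br"
    and left_leibniz: "br x (br y z) = br (br x y) z + br y (br x z)"

locale nijenhuis_leibniz_algebra = leibniz_algebra scale br
  for scale :: "'k::field_char_0 \<Rightarrow> 'a::ab_group_add \<Rightarrow> 'a" and br +
  fixes N :: "'a \<Rightarrow> 'a"
  assumes N_linear: "Vector_Spaces.linear scale scale N"
    and nijenhuis: "br (N x) (N y) = N (br (N x) y + br x (N y) - N (br x y))"

locale nla_morphism =
  dom: nijenhuis_leibniz_algebra sa bra Na + cod: nijenhuis_leibniz_algebra sb brb Nb
  for sa :: "'k::field_char_0 \<Rightarrow> 'a::ab_group_add \<Rightarrow> 'a" and bra Na
    and sb :: "'k \<Rightarrow> 'b::ab_group_add \<Rightarrow> 'b" and brb Nb +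
  fixes f :: "'a \<Rightarrow> 'b"
  assumes f_linear: "Vector_Spaces.linear sa sb f"
    and f_br: "f (bra x y) = brb (f x) (f y)"
    and f_N: "f (Na x) = Nb (f x)"

locale abelian_extension =
  incl: nla_morphism sv "\<lambda>_ _. 0" Nv se bre Ne i + proj: nla_morphism se bre Ne sg brg Ng p
  for sg :: "'k::field_char_0 \<Rightarrow> 'g::ab_group_add \<Rightarrow> 'g" and brg Ng
    and sv :: "'k \<Rightarrow> 'v::ab_group_add \<Rightarrow> 'v" and Nv
    and se :: "'k \<Rightarrow> 'e::ab_group_add \<Rightarrow> 'e" and bre Ne
    and i :: "'v \<Rightarrow> 'e" and p :: "'e \<Rightarrow> 'g" +
  assumes incl_inj: "inj i"
    and proj_surj: "surj p"
    and exact: "range i = {e. p e = 0}"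

definition isomorphic_extensions ::
  "('k::field_char_0 \<Rightarrow> 'e::ab_group_add \<Rightarrow> 'e) \<Rightarrow> ('e \<Rightarrow> 'e \<Rightarrow> 'e) \<Rightarrow> ('e \<Rightarrow> 'e) \<Rightarrow>
   ('v \<Rightarrow> 'e) \<Rightarrow> ('e \<Rightarrow> 'g) \<Rightarrow>
   ('k \<Rightarrow> 'e2::ab_group_add \<Rightarrow> 'e2) \<Rightarrow> ('e2 \<Rightarrow> 'e2 \<Rightarrow> 'e2) \<Rightarrow> ('e2 \<Rightarrow> 'e2) \<Rightarrow>
   ('v \<Rightarrow> 'e2) \<Rightarrow> ('e2 \<Rightarrow> 'g) \<Rightarrow> bool" where
  "isomorphic_extensions se1 br1 N1 i1 p1 se2 br2 N2 i2 p2 \<longleftrightarrow>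
     (\<exists>\<xi>. nla_morphism se1 br1 N1 se2 br2 N2 \<xi> \<and> bij \<xi> \<and> \<xi> \<circ> i1 = i2 \<and> p2 \<circ> \<xi> = p1)"

definition is_section ::
  "('k::field_char_0 \<Rightarrow> 'g::ab_group_add \<Rightarrow> 'g) \<Rightarrow> ('k \<Rightarrow> 'e::ab_group_add \<Rightarrow> 'e) \<Rightarrow>
   ('e \<Rightarrow> 'g) \<Rightarrow> ('g \<Rightarrow> 'e) \<Rightarrow> bool" where
  "is_section sg se p s \<longleftrightarrow> Vector_Spaces.linear sg se s \<and> p \<circ> s = id"

text \<open>
  The data induced by a section take values in the range of \<open>i\<close>, which equals the kernel
  of \<open>p\<close>; since \<open>V\<close> is a separate type, \<open>inv i\<close> carries them back to \<open>V\<close>.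
\<close>

definition induced_l :: "('e \<Rightarrow> 'e \<Rightarrow> 'e) \<Rightarrow> ('v \<Rightarrow> 'e) \<Rightarrow> ('g \<Rightarrow> 'e) \<Rightarrow> 'g \<Rightarrow> 'v \<Rightarrow> 'v" where
  "induced_l bre i s x u = inv i (bre (s x) (i u))"

definition induced_r :: "('e \<Rightarrow> 'e \<Rightarrow> 'e) \<Rightarrow> ('v \<Rightarrow> 'e) \<Rightarrow> ('g \<Rightarrow> 'e) \<Rightarrow> 'v \<Rightarrow> 'g \<Rightarrow> 'v" where
  "induced_r bre i s u x = inv i (bre (i u) (s x))"

definition induced_psi ::
  "('g \<Rightarrow> 'g \<Rightarrow> 'g) \<Rightarrow> ('e::ab_group_add \<Rightarrow> 'e \<Rightarrow> 'e) \<Rightarrow> ('v \<Rightarrow> 'e) \<Rightarrow> ('g \<Rightarrow> 'e) \<Rightarrow>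
   'g \<Rightarrow> 'g \<Rightarrow> 'v" where
  "induced_psi brg bre i s x y = inv i (bre (s x) (s y) - s (brg x y))"

definition induced_chi ::
  "('g \<Rightarrow> 'g) \<Rightarrow> ('e::ab_group_add \<Rightarrow> 'e) \<Rightarrow> ('v \<Rightarrow> 'e) \<Rightarrow> ('g \<Rightarrow> 'e) \<Rightarrow> 'g \<Rightarrow> 'v" where
  "induced_chi Ng Ne i s x = inv i (Ne (s x) - s (Ng x))"

text \<open>
  A 2-cochain is represented as a pair of a map \<open>'g \<Rightarrow> 'g \<Rightarrow> 'v\<close> (bilinear, in place of a
  linear map on the tensor square) and a map \<open>'g \<Rightarrow> 'v\<close>.
\<close>

definition delta1 ::
  "('g \<Rightarrow> 'g \<Rightarrow> 'g) \<Rightarrow> ('g \<Rightarrow> 'v \<Rightarrow> 'v) \<Rightarrow> ('v \<Rightarrow> 'g \<Rightarrow> 'v) \<Rightarrow>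
   ('g \<Rightarrow> 'v::ab_group_add) \<Rightarrow> 'g \<Rightarrow> 'g \<Rightarrow> 'v" where
  "delta1 brg l r f x y = l x (f y) + r (f x) y - f (brg x y)"

definition partial0 ::
  "('g \<Rightarrow> 'g) \<Rightarrow> ('v \<Rightarrow> 'v) \<Rightarrow> ('v \<Rightarrow> 'g \<Rightarrow> 'v) \<Rightarrow> 'v::ab_group_add \<Rightarrow> 'g \<Rightarrow> 'v" where
  "partial0 Ng Nv r g x = - (r g (Ng x) - Nv (r g x) + r (Nv g) x)"

definition phi1 ::
  "('g \<Rightarrow> 'g) \<Rightarrow> ('v \<Rightarrow> 'v) \<Rightarrow> ('g \<Rightarrow> 'v::ab_group_add) \<Rightarrow> 'g \<Rightarrow> 'v" where
  "phi1 Ng Nv f x = f (Ng x) - Nv (f x)"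

definition d1 ::
  "('g \<Rightarrow> 'g \<Rightarrow> 'g) \<Rightarrow> ('g \<Rightarrow> 'g) \<Rightarrow> ('v \<Rightarrow> 'v) \<Rightarrow> ('g \<Rightarrow> 'v \<Rightarrow> 'v) \<Rightarrow> ('v \<Rightarrow> 'g \<Rightarrow> 'v) \<Rightarrow>
   ('g \<Rightarrow> 'v::ab_group_add) \<times> 'v \<Rightarrow> ('g \<Rightarrow> 'g \<Rightarrow> 'v) \<times> ('g \<Rightarrow> 'v)" where
  "d1 brg Ng Nv l r = (\<lambda>(f, g). (delta1 brg l r f, \<lambda>x. - partial0 Ng Nv r g x - phi1 Ng Nv f x))"

definition C1_NLA ::
  "('k::field_char_0 \<Rightarrow> 'g::ab_group_add \<Rightarrow> 'g) \<Rightarrow> ('k \<Rightarrow> 'v::ab_group_add \<Rightarrow> 'v) \<Rightarrow>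
   (('g \<Rightarrow> 'v) \<times> 'v) set" where
  "C1_NLA sg sv = {f. Vector_Spaces.linear sg sv f} \<times> UNIV"

definition B2_NLA ::
  "('k::field_char_0 \<Rightarrow> 'g::ab_group_add \<Rightarrow> 'g) \<Rightarrow> ('g \<Rightarrow> 'g \<Rightarrow> 'g) \<Rightarrow> ('g \<Rightarrow> 'g) \<Rightarrow>
   ('k \<Rightarrow> 'v::ab_group_add \<Rightarrow> 'v) \<Rightarrow> ('v \<Rightarrow> 'v) \<Rightarrow> ('g \<Rightarrow> 'v \<Rightarrow> 'v) \<Rightarrow> ('v \<Rightarrow> 'g \<Rightarrow> 'v) \<Rightarrow>
   (('g \<Rightarrow> 'g \<Rightarrow> 'v) \<times> ('g \<Rightarrow> 'v)) set" where
  "B2_NLA sg brg Ng sv Nv l r = d1 brg Ng Nv l r ` C1_NLA sg sv"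

text \<open>
  The class of \<open>c\<close> is its coset modulo the coboundaries. As these form a subspace for bilinear
  \<open>l\<close> and \<open>r\<close>, two pairs have the same class iff they differ by a coboundary. Being a cocycle
  is not built in: it does not affect whether two classes coincide.
\<close>

definition H2_NLA_class ::
  "('k::field_char_0 \<Rightarrow> 'g::ab_group_add \<Rightarrow> 'g) \<Rightarrow> ('g \<Rightarrow> 'g \<Rightarrow> 'g) \<Rightarrow> ('g \<Rightarrow> 'g) \<Rightarrow>
   ('k \<Rightarrow> 'v::ab_group_add \<Rightarrow> 'v) \<Rightarrow> ('v \<Rightarrow> 'v) \<Rightarrow> ('g \<Rightarrow> 'v \<Rightarrow> 'v) \<Rightarrow> ('v \<Rightarrow> 'g \<Rightarrow> 'v) \<Rightarrow>
   ('g \<Rightarrow> 'g \<Rightarrow> 'v) \<times> ('g \<Rightarrow> 'v) \<Rightarrow> (('g \<Rightarrow> 'g \<Rightarrow> 'v) \<times> ('g \<Rightarrow> 'v)) set" where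
  "H2_NLA_class sg brg Ng sv Nv l r c = c +o B2_NLA sg brg Ng sv Nv l r"

end

theory Submission imports Defs begin

text \<open>
  An isomorphism \<open>\<xi>\<close> of extensions turns a section \<open>s\<close> of the first extension into the section
  \<open>\<xi> \<circ> s\<close> of the second one. Because \<open>\<xi>\<close> is the identity on \<open>V\<close> and preserves brackets and
  Nijenhuis operators, \<open>s\<close> and \<open>\<xi> \<circ> s\<close> induce literally the same maps and the same cochain
  (the lemmas \<open>induced_l_morphism\<close> to \<open>induced_chi_morphism\<close>).

  It therefore suffices to compare two sections \<open>s\<close>, \<open>t\<close> of a single extension. They differ by
  \<open>i \<circ> f\<close> for a linear \<open>f\<close> from \<open>\<gg>\<close> to \<open>V\<close>, since \<open>p\<close> kills the difference. As \<open>V\<close> is abelian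
  inside the extension, adding elements of \<open>V\<close> to \<open>s\<close> does not affect its action on \<open>V\<close>, so
  the two representations agree. Expanding the bracket of \<open>t x = s x + i (f x)\<close> and
  \<open>t y = s y + i (f y)\<close> (with no term quadratic in \<open>f\<close>, again because \<open>V\<close> is abelian), and
  expanding the Nijenhuis operator on \<open>t x\<close>, shows that the cochain of \<open>t\<close> exceeds that of \<open>s\<close>
  by exactly \<open>d\<^sup>1 (f, 0)\<close>. Since the coboundaries form a subgroup, the two cosets coincide.
\<close>

section \<open>Linear and bilinear maps\<close>

lemma linear_module_hom: "Vector_Spaces.linear sa sb f \<Longrightarrow> module_hom sa sb f"
  by (simp add: Vector_Spaces.linear_def)

lemmas linear_map_add = module_hom.add[OF linear_module_hom]
  and linear_map_diff = module_hom.diff[OF linear_module_hom]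
  and linear_map_zero = module_hom.zero[OF linear_module_hom]
  and linear_map_scale = module_hom.scale[OF linear_module_hom]

lemma bilinear_map_add:
  assumes "bilinear_map sa sb sc h"
  shows "h (x + x') y = h x y + h x' y" and "h x (y + y') = h x y + h x y'"
proof -
  have lin: "Vector_Spaces.linear sb sc (h x)" "Vector_Spaces.linear sa sc (\<lambda>x. h x y)"
    using assms by (auto simp: bilinear_map_def)
  show "h (x + x') y = h x y + h x' y" using linear_map_add[OF lin(2)] by simp
  show "h x (y + y') = h x y + h x y'" by (rule linear_map_add[OF lin(1)])
qed

section \<open>Cosets of coboundaries\<close>

lemma elt_set_plus_subgroup_eq:
  fixes B :: "'a::ab_group_add set"
  assumes add: "\<And>x y. x \<in> B \<Longrightarrow> y \<in> B \<Longrightarrow> x + y \<in> B"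
    and minus: "\<And>x. x \<in> B \<Longrightarrow> - x \<in> B"
    and diff: "c - d \<in> B"
  shows "c +o B = d +o B"
proof -
  have coset_sub: "u +o B \<subseteq> v +o B" if "u - v \<in> B" for u v
  proof
    fix w assume "w \<in> u +o B"
    then obtain b where b: "b \<in> B" and w: "w = u + b" by (auto simp: elt_set_plus_def)
    have "w = v + ((u - v) + b)" by (simp add: w)
    with add[OF that b] show "w \<in> v +o B" by (simp only: elt_set_plus_def) blast
  qed
  have "d - c \<in> B" using minus[OF diff] by simp
  with diff coset_sub show ?thesis by blast
qed

lemma d1_add:
  assumes Nv: "Vector_Spaces.linear sv sv Nv"
    and l: "\<And>x u v. l x (u + v) = l x u + l x v"
    and r: "\<And>x u v. r (u + v) x = r u x + r v x"
  shows "d1 brg Ng Nv l r (a + b) = d1 brg Ng Nv l r a + d1 brg Ng Nv l r b"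
  by (cases a; cases b)
    (auto simp: d1_def delta1_def partial0_def phi1_def fun_eq_iff l r linear_map_add[OF Nv]
      algebra_simps)

lemma B2_NLA_subgroup:
  assumes Nv: "Vector_Spaces.linear sv sv Nv" and sg: "vector_space sg"
    and l: "\<And>x u v. l x (u + v) = l x u + l x v"
    and r: "\<And>x u v. r (u + v) x = r u x + r v x"
  shows "a \<in> B2_NLA sg brg Ng sv Nv l r \<Longrightarrow> b \<in> B2_NLA sg brg Ng sv Nv l r \<Longrightarrow>
      a + b \<in> B2_NLA sg brg Ng sv Nv l r"
    and "a \<in> B2_NLA sg brg Ng sv Nv l r \<Longrightarrow> - a \<in> B2_NLA sg brg Ng sv Nv l r"
proof -
  let ?d = "d1 brg Ng Nv l r"
  have "vector_space sv" using Nv by (simp add: Vector_Spaces.linear_def)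
  then interpret vector_space_pair sg sv using sg by (simp add: vector_space_pair_def)
  interpret d: additive ?d by standard (rule d1_add[OF Nv l r])
  have C_add: "x + y \<in> C1_NLA sg sv" if "x \<in> C1_NLA sg sv" "y \<in> C1_NLA sg sv" for x y
    using that by (auto simp: C1_NLA_def plus_fun_def intro!: linear_compose_add)
  have C_minus: "- x \<in> C1_NLA sg sv" if "x \<in> C1_NLA sg sv" for x
    using that by (auto simp: C1_NLA_def fun_Compl_def intro!: linear_compose_neg)
  show "a + b \<in> B2_NLA sg brg Ng sv Nv l r"
    if "a \<in> B2_NLA sg brg Ng sv Nv l r" "b \<in> B2_NLA sg brg Ng sv Nv l r"
    using that C_add unfolding B2_NLA_def by (auto simp flip: d.add)
  show "- a \<in> B2_NLA sg brg Ng sv Nv l r" if "a \<in> B2_NLA sg brg Ng sv Nv l r"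
    using that C_minus unfolding B2_NLA_def by (auto simp flip: d.minus)
qed

section \<open>Two sections of one extension\<close>

context abelian_extension
begin

lemmas i_add = linear_map_add[OF incl.f_linear]
  and i_diff = linear_map_diff[OF incl.f_linear]
  and i_zero = linear_map_zero[OF incl.f_linear]
  and i_scale = linear_map_scale[OF incl.f_linear]
  and p_diff = linear_map_diff[OF proj.f_linear]
  and bre_add = bilinear_map_add[OF incl.cod.br_bilinear]
  and Ne_add = linear_map_add[OF incl.cod.N_linear]
  and Nv_zero = linear_map_zero[OF incl.dom.N_linear]

lemma i_inv: "p e = 0 \<Longrightarrow> i (inv i e) = e"
  using exact by (auto intro: f_inv_into_f)

lemma p_i: "p (i u) = 0"
  using exact by auto

lemma i_eqD: "i u = i v \<Longrightarrow> u = v"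
  using incl_inj by (simp add: inj_eq)

lemma bre_i_i: "bre (i u) (i v) = 0"
  using incl.f_br[of u v] i_zero by simp

lemma brg_zero: "brg 0 y = 0" "brg x 0 = 0"
  using bilinear_map_add[OF proj.cod.br_bilinear, of 0 0 y]
    bilinear_map_add(2)[OF proj.cod.br_bilinear, of x 0 0] by simp_all

lemma p_section: "is_section sg se p s \<Longrightarrow> p (s x) = x"
  by (simp add: is_section_def fun_eq_iff)

text \<open>
  Each of the arguments of \<open>inv i\<close> in the induced data is killed by \<open>p\<close>, so it does lie in the
  image of \<open>i\<close>; this is what gives the defining formulas their meaning.
\<close>

lemma i_induced:
  assumes s: "is_section sg se p s"
  shows "i (induced_l bre i s x u) = bre (s x) (i u)"
    and "i (induced_r bre i s u x) = bre (i u) (s x)"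
    and "i (induced_psi brg bre i s x y) = bre (s x) (s y) - s (brg x y)"
    and "i (induced_chi Ng Ne i s x) = Ne (s x) - s (Ng x)"
  unfolding induced_l_def induced_r_def induced_psi_def induced_chi_def
  by (rule i_inv, simp add: proj.f_br proj.f_N p_i brg_zero p_diff p_section[OF s])+

lemma induced_l_add:
  "is_section sg se p s \<Longrightarrow>
    induced_l bre i s x (u + v) = induced_l bre i s x u + induced_l bre i s x v"
  by (rule i_eqD) (simp add: i_induced i_add bre_add)

lemma induced_r_add:
  "is_section sg se p s \<Longrightarrow>
    induced_r bre i s (u + v) x = induced_r bre i s u x + induced_r bre i s v x"
  by (rule i_eqD) (simp add: i_induced i_add bre_add)

lemma sections_differ_by_linear:
  assumes s: "is_section sg se p s" and t: "is_section sg se p t"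
  obtains f where "Vector_Spaces.linear sg sv f" and "\<And>x. t x = s x + i (f x)"
proof
  define f where "f x = inv i (t x - s x)" for x
  have i_f: "i (f x) = t x - s x" for x
    unfolding f_def by (rule i_inv) (simp add: p_diff p_section s t)
  have lin: "Vector_Spaces.linear sg se s" "Vector_Spaces.linear sg se t"
    using s t by (simp_all add: is_section_def)
  show "Vector_Spaces.linear sg sv f"
    unfolding Vector_Spaces.linear_iff
  proof (intro conjI allI proj.cod.vector_space_axioms incl.dom.vector_space_axioms)
    show "f (x + y) = f x + f y" for x y
      by (rule i_eqD) (simp add: i_f i_add linear_map_add[OF lin(1)] linear_map_add[OF lin(2)])
    show "f (sg c x) = sv c (f x)" for c x
      by (rule i_eqD) (simp add: i_f i_scale linear_map_scale[OF lin(1)]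
          linear_map_scale[OF lin(2)] incl.cod.scale_right_diff_distrib)
  qed
  show "t x = s x + i (f x)" for x by (simp add: i_f)
qed

lemma induced_l_section_independent:
  assumes s: "is_section sg se p s" and t: "is_section sg se p t"
  shows "induced_l bre i s = induced_l bre i t"
proof -
  obtain f where f: "\<And>x. t x = s x + i (f x)" using sections_differ_by_linear[OF s t] by blast
  show ?thesis by (intro ext i_eqD) (simp add: i_induced s t f bre_add bre_i_i)
qed

lemma induced_r_section_independent:
  assumes s: "is_section sg se p s" and t: "is_section sg se p t"
  shows "induced_r bre i s = induced_r bre i t"
proof -
  obtain f where f: "\<And>x. t x = s x + i (f x)" using sections_differ_by_linear[OF s t] by blast
  show ?thesis by (intro ext i_eqD) (simp add: i_induced s t f bre_add bre_i_i)
qed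

text \<open>
  Writing \<open>t = s + i \<circ> f\<close>, the difference of the cochains is \<open>d\<^sup>1 (f, 0)\<close>. The cross terms of
  \<open>[t x, t y]\<close> are the two action terms of \<open>\<delta>\<^sup>1 f\<close>, and its last term comes from subtracting
  \<open>t [x, y]\<close>. Likewise the terms of \<open>- \<phi>\<^sup>1 f\<close> come from applying the Nijenhuis operator to
  \<open>i (f x)\<close> and from subtracting \<open>t (N x)\<close>.
\<close>

lemma cochain_diff_coboundary:
  assumes s: "is_section sg se p s" and t: "is_section sg se p t"
  shows "(induced_psi brg bre i t, induced_chi Ng Ne i t) -
      (induced_psi brg bre i s, induced_chi Ng Ne i s)
    \<in> B2_NLA sg brg Ng sv Nv (induced_l bre i s) (induced_r bre i s)"
proof -
  let ?l = "induced_l bre i s" and ?r = "induced_r bre i s"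
  obtain f where lin: "Vector_Spaces.linear sg sv f" and f: "\<And>x. t x = s x + i (f x)"
    using sections_differ_by_linear[OF s t] by blast
  have psi: "induced_psi brg bre i t x y - induced_psi brg bre i s x y = delta1 brg ?l ?r f x y"
    for x y
    by (rule i_eqD)
      (simp add: delta1_def i_add i_diff i_induced s t f bre_add bre_i_i algebra_simps)
  have chi: "induced_chi Ng Ne i t x - induced_chi Ng Ne i s x = - phi1 Ng Nv f x" for x
    by (rule i_eqD)
      (simp add: phi1_def i_diff i_induced s t f Ne_add incl.f_N algebra_simps)
  have r_zero: "?r 0 x = 0" for x
    using induced_r_add[OF s, of 0 0 x] by simp
  have partial: "partial0 Ng Nv ?r 0 x = 0" for x
    by (simp add: partial0_def r_zero Nv_zero)
  have "(induced_psi brg bre i t, induced_chi Ng Ne i t) -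
      (induced_psi brg bre i s, induced_chi Ng Ne i s) = d1 brg Ng Nv ?l ?r (f, 0)"
    by (simp add: d1_def fun_eq_iff psi chi partial)
  moreover have "(f, 0) \<in> C1_NLA sg sv" using lin by (simp add: C1_NLA_def)
  ultimately show ?thesis unfolding B2_NLA_def by blast
qed

lemma H2_NLA_class_section_independent:
  assumes s: "is_section sg se p s" and t: "is_section sg se p t"
  shows "H2_NLA_class sg brg Ng sv Nv (induced_l bre i s) (induced_r bre i s)
      (induced_psi brg bre i t, induced_chi Ng Ne i t) =
    H2_NLA_class sg brg Ng sv Nv (induced_l bre i s) (induced_r bre i s)
      (induced_psi brg bre i s, induced_chi Ng Ne i s)"
  unfolding H2_NLA_class_def
  by (intro elt_set_plus_subgroup_eq cochain_diff_coboundary s t)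
    (intro B2_NLA_subgroup incl.dom.N_linear proj.cod.vector_space_axioms
      induced_l_add induced_r_add s; assumption)+

end

section \<open>Transport along a morphism of extensions\<close>

text \<open>
  This is why the induced data do not change: an element of one extension and its image in the
  other are read as the same element of \<open>V\<close>.
\<close>

lemma inv_comp_inj:
  assumes "inj \<xi>"
  shows "inv (\<xi> \<circ> i) (\<xi> e) = inv i e"
  using assms by (simp add: inv_into_def inj_eq)

context
  fixes sa :: "'k::field_char_0 \<Rightarrow> 'a::ab_group_add \<Rightarrow> 'a" and bra Na
    and sb :: "'k \<Rightarrow> 'b::ab_group_add \<Rightarrow> 'b" and brb Nb
    and \<xi> :: "'a \<Rightarrow> 'b"
  assumes morph: "nla_morphism sa bra Na sb brb Nb \<xi>" and inj: "inj \<xi>"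
begin

interpretation nla_morphism sa bra Na sb brb Nb \<xi> by (rule morph)

lemma induced_l_morphism: "induced_l brb (\<xi> \<circ> i) (\<xi> \<circ> s) = induced_l bra i s"
  by (simp add: induced_l_def fun_eq_iff inv_comp_inj[OF inj] flip: f_br)

lemma induced_r_morphism: "induced_r brb (\<xi> \<circ> i) (\<xi> \<circ> s) = induced_r bra i s"
  by (simp add: induced_r_def fun_eq_iff inv_comp_inj[OF inj] flip: f_br)

lemma induced_psi_morphism: "induced_psi brg brb (\<xi> \<circ> i) (\<xi> \<circ> s) = induced_psi brg bra i s"
  by (simp add: induced_psi_def fun_eq_iff inv_comp_inj[OF inj]
      flip: f_br linear_map_diff[OF f_linear])

lemma induced_chi_morphism: "induced_chi Ng Nb (\<xi> \<circ> i) (\<xi> \<circ> s) = induced_chi Ng Na i s"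
  by (simp add: induced_chi_def fun_eq_iff inv_comp_inj[OF inj]
      flip: f_N linear_map_diff[OF f_linear])

lemma is_section_morphism:
  assumes "is_section sg sa (q \<circ> \<xi>) s"
  shows "is_section sg sb q (\<xi> \<circ> s)"
  using assms f_linear by (auto simp: is_section_def o_assoc intro: Vector_Spaces.linear_compose)

end

section \<open>Isomorphic extensions\<close>

theorem proposition6p7:
  fixes sg :: "'k::field_char_0 \<Rightarrow> 'g::ab_group_add \<Rightarrow> 'g"
    and sv :: "'k \<Rightarrow> 'v::ab_group_add \<Rightarrow> 'v"
    and se1 :: "'k \<Rightarrow> 'e1::ab_group_add \<Rightarrow> 'e1"
    and se2 :: "'k \<Rightarrow> 'e2::ab_group_add \<Rightarrow> 'e2"
    and brg :: "'g \<Rightarrow> 'g \<Rightarrow> 'g" and Ng :: "'g \<Rightarrow> 'g" and Nv :: "'v \<Rightarrow> 'v"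
    and br1 :: "'e1 \<Rightarrow> 'e1 \<Rightarrow> 'e1" and N1 :: "'e1 \<Rightarrow> 'e1"
    and br2 :: "'e2 \<Rightarrow> 'e2 \<Rightarrow> 'e2" and N2 :: "'e2 \<Rightarrow> 'e2"
    and i1 :: "'v \<Rightarrow> 'e1" and p1 :: "'e1 \<Rightarrow> 'g"
    and i2 :: "'v \<Rightarrow> 'e2" and p2 :: "'e2 \<Rightarrow> 'g"
    and s1 :: "'g \<Rightarrow> 'e1" and s2 :: "'g \<Rightarrow> 'e2"
  assumes "abelian_extension sg brg Ng sv Nv se1 br1 N1 i1 p1"
    and "abelian_extension sg brg Ng sv Nv se2 br2 N2 i2 p2"
    and "isomorphic_extensions se1 br1 N1 i1 p1 se2 br2 N2 i2 p2"
    and "is_section sg se1 p1 s1"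
    and "is_section sg se2 p2 s2"
  shows "induced_l br1 i1 s1 = induced_l br2 i2 s2 \<and>
    induced_r br1 i1 s1 = induced_r br2 i2 s2 \<and>
    H2_NLA_class sg brg Ng sv Nv (induced_l br1 i1 s1) (induced_r br1 i1 s1)
        (induced_psi brg br1 i1 s1, induced_chi Ng N1 i1 s1) =
      H2_NLA_class sg brg Ng sv Nv (induced_l br2 i2 s2) (induced_r br2 i2 s2)
        (induced_psi brg br2 i2 s2, induced_chi Ng N2 i2 s2)"
proof -
  interpret E2: abelian_extension sg brg Ng sv Nv se2 br2 N2 i2 p2 by (rule assms(2))
  obtain \<xi> where morph: "nla_morphism se1 br1 N1 se2 br2 N2 \<xi>" and "bij \<xi>"
    and i2: "i2 = \<xi> \<circ> i1" and p1: "p1 = p2 \<circ> \<xi>"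
    using assms(3) by (auto simp: isomorphic_extensions_def)
  then have inj: "inj \<xi>" by (simp add: bij_is_inj)
  have t: "is_section sg se2 p2 (\<xi> \<circ> s1)"
    using is_section_morphism[OF morph inj] assms(4) unfolding p1 .
  have same: "induced_l br2 i2 (\<xi> \<circ> s1) = induced_l br1 i1 s1"
      "induced_r br2 i2 (\<xi> \<circ> s1) = induced_r br1 i1 s1"
      "induced_psi brg br2 i2 (\<xi> \<circ> s1) = induced_psi brg br1 i1 s1"
      "induced_chi Ng N2 i2 (\<xi> \<circ> s1) = induced_chi Ng N1 i1 s1"
    unfolding i2
    by (rule induced_l_morphism[OF morph inj] induced_r_morphism[OF morph inj]
        induced_psi_morphism[OF morph inj] induced_chi_morphism[OF morph inj])+
  have l: "induced_l br1 i1 s1 = induced_l br2 i2 s2"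
    using E2.induced_l_section_independent[OF t assms(5)] by (simp add: same)
  have r: "induced_r br1 i1 s1 = induced_r br2 i2 s2"
    using E2.induced_r_section_independent[OF t assms(5)] by (simp add: same)
  show ?thesis
    using E2.H2_NLA_class_section_independent[OF assms(5) t] by (simp add: same l r)
qed

end
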